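(* Let $h$ be a finite set and $F_h:2^h\to\mathbb{R}$ a non-decreasing submodular function with $F_h(\emptyset)=0$ and $F_h(\{i\})>0$ for all $i\in h$, and let $\delta_h(S)=\min\{F_h(S),F_h(h\setminus S)\}$. Then $$\big(\mathcal{P}_{\mathrm{sym}}(F_h)\cap\mathbf{1}^\perp\big)\subseteq\mathcal{B}(\delta_h)\subseteq2\cdot\big(\mathcal{P}_{\mathrm{sym}}(F_h)\cap\mathbf{1}^\perp\big).$$ In particular, for all $\mathbf{x}\in\mathbb{R}^h$, $$\min_{u\in\mathbb{R}}\|\mathbf{x}-u\mathbf{1}\|_{F_h}\le\bar\delta_h(\mathbf{x})\le2\min_{u\in\mathbb{R}}\|\mathbf{x}-u\mathbf{1}\|_{F_h}.$$
   Context: For a submodular $F:2^h\to\mathbb{R}$ with $F(\emptyset)=0$: the base polytope is $\mathcal{B}(F)=\{\mathbf{x}\in\mathbb{R}^h:\langle\mathbf{x},\mathbf{1}\rangle=F(h),\ \langle\mathbf{x},\mathbf{1}^S\rangle\le F(S)\ \forall S\subseteq h\}$; the Lovász extension is $\bar F(\mathbf{x})=\max_{\mathbf{y}\in\mathcal{B}(F)}\langle\mathbf{x},\mathbf{y}\rangle$. For non-decreasing submodular $F$ with $F(\emptyset)=0$ and $F(\{i\})>0$ for all $i$, $\|\mathbf{x}\|_F=\bar F(|\mathbf{x}|)$ (with $|\mathbf{x}|$ entrywise absolute value) is a norm, and the symmetric submodular polyhedron is $\mathcal{P}_{\mathrm{sym}}(F)=\{\mathbf{x}\in\mathbb{R}^h:\sum_{i\in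 S}|x_i|\le F(S)\ \forall S\subseteq h\}$. $\mathbf{1}^\perp=\{\mathbf{x}:\langle\mathbf{x},\mathbf{1}\rangle=0\}$. *)

theory Defs
  imports Complex_Main "HOL-Library.FuncSet" "HOL-Library.Indicator_Function"
begin

text \<open>
  The ground set is an arbitrary finite set \<open>h\<close>, possibly empty. A vector of \<open>\<real>\<^sup>h\<close> is an
  extensional function (equal to \<open>undefined\<close> outside \<open>h\<close>), so that equality and inclusion
  are those of \<open>\<real>\<^sup>h\<close>. Set functions \<open>2\<^sup>h \<Rightarrow> \<real>\<close> are functions on \<^typ>\<open>'a set\<close> of which only the
  values on subsets of \<open>h\<close> are used.
\<close>

definition vecs :: "'a set \<Rightarrow> ('a \<Rightarrow> real) set" where
  "vecs h = h \<rightarrow>\<^sub>E UNIV"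

definition inner_on :: "'a set \<Rightarrow> ('a \<Rightarrow> real) \<Rightarrow> ('a \<Rightarrow> real) \<Rightarrow> real" where
  "inner_on h x y = (\<Sum>i\<in>h. x i * y i)"

definition ind_vec :: "'a set \<Rightarrow> 'a set \<Rightarrow> 'a \<Rightarrow> real" where
  "ind_vec h S = restrict (indicator S) h"

abbreviation one_vec :: "'a set \<Rightarrow> 'a \<Rightarrow> real" where
  "one_vec h \<equiv> ind_vec h h"

definition scale_vec :: "'a set \<Rightarrow> real \<Rightarrow> ('a \<Rightarrow> real) \<Rightarrow> 'a \<Rightarrow> real" where
  "scale_vec h c x = (\<lambda>i\<in>h. c * x i)"

definition diff_vec :: "'a set \<Rightarrow> ('a \<Rightarrow> real) \<Rightarrow> ('a \<Rightarrow> real) \<Rightarrow> 'a \<Rightarrow> real" where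
  "diff_vec h x y = (\<lambda>i\<in>h. x i - y i)"

definition abs_vec :: "'a set \<Rightarrow> ('a \<Rightarrow> real) \<Rightarrow> 'a \<Rightarrow> real" where
  "abs_vec h x = (\<lambda>i\<in>h. \<bar>x i\<bar>)"

definition submodular_on :: "'a set \<Rightarrow> ('a set \<Rightarrow> real) \<Rightarrow> bool" where
  "submodular_on h F \<longleftrightarrow>
     (\<forall>S T. S \<subseteq> h \<longrightarrow> T \<subseteq> h \<longrightarrow> F (S \<union> T) + F (S \<inter> T) \<le> F S + F T)"

definition base_polytope :: "'a set \<Rightarrow> ('a set \<Rightarrow> real) \<Rightarrow> ('a \<Rightarrow> real) set" where
  "base_polytope h F =
     {x \<in> vecs h. inner_on h x (one_vec h) = F h \<and>
                  (\<forall>S. S \<subseteq> h \<longrightarrow> inner_on h x (ind_vec h S) \<le> F S)}"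

text \<open>
  \<open>GREATEST\<close> (rather than \<open>Sup\<close>) renders a maximum that is attained; it is meaningful when
  \<open>F\<close> is submodular with \<open>F {} = 0\<close>, as then the base polytope is nonempty and compact.
\<close>

definition lovasz_ext :: "'a set \<Rightarrow> ('a set \<Rightarrow> real) \<Rightarrow> ('a \<Rightarrow> real) \<Rightarrow> real" where
  "lovasz_ext h F x = (GREATEST r. \<exists>y \<in> base_polytope h F. r = inner_on h x y)"

definition submod_norm :: "'a set \<Rightarrow> ('a set \<Rightarrow> real) \<Rightarrow> ('a \<Rightarrow> real) \<Rightarrow> real" where
  "submod_norm h F x = lovasz_ext h F (abs_vec h x)"

definition sym_polyhedron :: "'a set \<Rightarrow> ('a set \<Rightarrow> real) \<Rightarrow> ('a \<Rightarrow> real) set" where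
  "sym_polyhedron h F = {x \<in> vecs h. \<forall>S. S \<subseteq> h \<longrightarrow> (\<Sum>i\<in>S. \<bar>x i\<bar>) \<le> F S}"

definition one_perp :: "'a set \<Rightarrow> ('a \<Rightarrow> real) set" where
  "one_perp h = {x \<in> vecs h. inner_on h x (one_vec h) = 0}"

definition delta :: "'a set \<Rightarrow> ('a set \<Rightarrow> real) \<Rightarrow> 'a set \<Rightarrow> real" where
  "delta h F S = min (F S) (F (h - S))"

text \<open>The base polytope and the Lovasz extension of \<open>delta h F\<close> are thus well defined:\<close>

lemma submodular_on_delta:
  assumes sub: "submodular_on h F" and mono: "mono_on (Pow h) F"
  shows "submodular_on h (delta h F)"
  unfolding submodular_on_def
proof (intro allI impI)
  fix S T assume S: "S \<subseteq> h" and T: "T \<subseteq> h"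
  have m: "F A \<le> F B" if "A \<subseteq> B" "B \<subseteq> h" for A B
    using mono that unfolding mono_on_def by (meson PowI order_trans)
  have s: "F (A \<union> B) + F (A \<inter> B) \<le> F A + F B" if "A \<subseteq> h" "B \<subseteq> h" for A B
    using sub that unfolding submodular_on_def by blast
  have compl: "(h - S) \<union> (h - T) = h - (S \<inter> T)" "(h - S) \<inter> (h - T) = h - (S \<union> T)"
    by auto
  have 1: "F (S \<union> T) + F (S \<inter> T) \<le> F S + F T"
    using s[OF S T] .
  have 2: "F (h - (S \<inter> T)) + F (h - (S \<union> T)) \<le> F (h - S) + F (h - T)"
    using s[of "h - S" "h - T"] compl by auto
  have 3: "F (S \<inter> T) \<le> F S" "F (h - (S \<union> T)) \<le> F (h - T)"
    "F (S \<inter> T) \<le> F T" "F (h - (S \<union> T)) \<le> F (h - S)"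
    using S T by (auto intro!: m)
  show "delta h F (S \<union> T) + delta h F (S \<inter> T) \<le> delta h F S + delta h F T"
    using 1 2 3 unfolding delta_def by linarith
qed

end

theory Submission
  imports Defs
begin

text \<open>
  The inclusions are elementary. Edmonds' greedy vertex of the base polytope, whose optimality is
  Abel summation along an enumeration that decreases \<open>x\<close>, shows that the Lovasz extension is
  attained and dominates \<open>\<langle>x,y\<rangle>\<close> for \<open>y\<close> below \<open>F\<close>; with the second inclusion this gives the upper
  bound. For the lower bound let \<open>S\<^sub>k\<close> be the first \<open>k\<close> elements of the enumeration.
  Up to some index \<open>m\<close> the minimum defining \<open>\<delta>(S\<^sub>k)\<close> is \<open>F(S\<^sub>k)\<close>, afterwards it is
  \<open>F(h - S\<^sub>k)\<close>; taking for \<open>u\<close> the value of \<open>x\<close> at the crossing, the greedy vertex of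
  \<open>\<B>(\<delta>)\<close> pairs with \<open>x - u\<one>\<close> at least as much as any \<open>y \<in> \<B>(F)\<close> pairs with
  \<open>|x - u\<one>|\<close>, by Abel summation on either side of \<open>m\<close>.
\<close>

section \<open>Abel summation inequalities\<close>

text \<open>The induction raises the lower bound to the last value \<open>a n\<close>, which by
  monotonicity still bounds the earlier terms from below; replacing \<open>c\<close> by
  \<open>a n\<close> costs nothing because the full sum of \<open>d\<close> is nonnegative.\<close>

lemma Abel_le_head:
  fixes a d :: "nat \<Rightarrow> real"
  assumes "\<And>i j. i \<le> j \<Longrightarrow> j < n \<Longrightarrow> a j \<le> a i"
    and "\<And>k. k \<le> n \<Longrightarrow> 0 \<le> (\<Sum>j<k. d j)"
    and "\<And>k. k < n \<Longrightarrow> c \<le> a k"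
  shows "c * (\<Sum>k<n. d k) \<le> (\<Sum>k<n. a k * d k)"
  using assms
proof (induction n arbitrary: c)
  case 0
  then show ?case by simp
next
  case (Suc n)
  have "a n * (\<Sum>k<n. d k) \<le> (\<Sum>k<n. a k * d k)"
    by (rule Suc.IH) (auto intro: Suc.prems)
  moreover have "c * (\<Sum>k<Suc n. d k) \<le> a n * (\<Sum>k<Suc n. d k)"
    by (intro mult_right_mono Suc.prems) auto
  ultimately show ?case by (simp add: distrib_left)
qed

text \<open>Mirror image for increasing \<open>a\<close> and nonnegative suffix sums: the induction
  prepends terms, running downwards from \<open>m = n\<close>.\<close>

lemma Abel_le_tail:
  fixes a d :: "nat \<Rightarrow> real"
  assumes "m \<le> n"
    and "\<And>i j. m \<le> i \<Longrightarrow> i \<le> j \<Longrightarrow> j < n \<Longrightarrow> a i \<le> a j"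
    and "\<And>k. m \<le> k \<Longrightarrow> k \<le> n \<Longrightarrow> 0 \<le> (\<Sum>j=k..<n. d j)"
    and "\<And>k. m \<le> k \<Longrightarrow> k < n \<Longrightarrow> c \<le> a k"
  shows "c * (\<Sum>k=m..<n. d k) \<le> (\<Sum>k=m..<n. a k * d k)"
  using assms
proof (induction m arbitrary: c rule: inc_induct)
  case base
  then show ?case by simp
next
  case (step m)
  have "a m * (\<Sum>k=Suc m..<n. d k) \<le> (\<Sum>k=Suc m..<n. a k * d k)"
    by (rule step.IH) (auto intro: step.prems)
  moreover have "c * (\<Sum>k=m..<n. d k) \<le> a m * (\<Sum>k=m..<n. d k)"
    using step.hyps by (intro mult_right_mono step.prems) auto
  ultimately show ?case
    using step.hyps by (simp add: sum.atLeast_Suc_lessThan distrib_left)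
qed

section \<open>Inner products with indicator vectors as subset sums\<close>

lemma inner_on_ind_vec: "finite h \<Longrightarrow> S \<subseteq> h \<Longrightarrow> inner_on h x (ind_vec h S) = sum x S"
  unfolding inner_on_def ind_vec_def
  by (auto simp: indicator_def sum.If_cases Int_absorb1 if_distrib cong: if_cong)

lemma mem_base_polytope_iff:
  "finite h \<Longrightarrow>
    x \<in> base_polytope h F \<longleftrightarrow> x \<in> vecs h \<and> sum x h = F h \<and> (\<forall>S\<subseteq>h. sum x S \<le> F S)"
  unfolding base_polytope_def by (auto simp: inner_on_ind_vec)

lemma mem_one_perp_iff: "finite h \<Longrightarrow> x \<in> one_perp h \<longleftrightarrow> x \<in> vecs h \<and> sum x h = 0"
  unfolding one_perp_def by (auto simp: inner_on_ind_vec)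

lemma delta_top: "mono_on (Pow h) F \<Longrightarrow> F {} = 0 \<Longrightarrow> delta h F h = 0"
  unfolding delta_def mono_on_def by (force simp: min_def)

lemma delta_empty: "mono_on (Pow h) F \<Longrightarrow> F {} = 0 \<Longrightarrow> delta h F {} = 0"
  unfolding delta_def mono_on_def by (force simp: min_def)

section \<open>The two inclusions\<close>

text \<open>Since \<open>x\<close> sums to zero, its sum over \<open>S\<close> is minus its sum over
  \<open>h - S\<close>, so the bounds on absolute values over \<open>S\<close> and over
  \<open>h - S\<close> both apply.\<close>

lemma sym_polyhedron_subset_base_polytope:
  assumes fin: "finite h" and mono: "mono_on (Pow h) F" and emp: "F {} = 0"
  shows "sym_polyhedron h F \<inter> one_perp h \<subseteq> base_polytope h (delta h F)"
proof
  fix x assume "x \<in> sym_polyhedron h F \<inter> one_perp h"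
  then have x: "x \<in> vecs h" "sum x h = 0" and le: "\<And>S. S \<subseteq> h \<Longrightarrow> (\<Sum>i\<in>S. \<bar>x i\<bar>) \<le> F S"
    using fin by (auto simp: mem_one_perp_iff sym_polyhedron_def)
  have "sum x S \<le> delta h F S" if S: "S \<subseteq> h" for S
  proof -
    have "sum x S \<le> F S" using le[OF S] sum_abs[of x S] by linarith
    moreover have "sum x S = - sum x (h - S)"
      using sum.subset_diff[OF S fin, of x] x by simp
    then have "sum x S \<le> F (h - S)"
      using le[OF Diff_subset[of h S]] sum_abs[of x "h - S"] by linarith
    ultimately show ?thesis by (simp add: delta_def)
  qed
  then show "x \<in> base_polytope h (delta h F)"
    using x fin mono emp by (simp add: mem_base_polytope_iff delta_top)
qed

text \<open>Split \<open>S\<close> by the sign of \<open>y\<close>. The positive part is bounded by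
  the \<open>F\<close> side of the minimum; the nonpositive part is minus the sum over its
  complement (as \<open>y\<close> sums to zero) and is bounded by the other side. Each bound is at
  most \<open>F S\<close>, whence the factor 2.\<close>

lemma base_polytope_delta_sum_abs_le:
  assumes fin: "finite h" and mono: "mono_on (Pow h) F" and emp: "F {} = 0"
    and y: "y \<in> base_polytope h (delta h F)" and S: "S \<subseteq> h"
  shows "(\<Sum>i\<in>S. \<bar>y i\<bar>) \<le> 2 * F S"
proof -
  let ?P = "{i\<in>S. 0 < y i}" and ?M = "{i\<in>S. \<not> 0 < y i}"
  have y0: "sum y h = 0" and le: "\<And>T. T \<subseteq> h \<Longrightarrow> sum y T \<le> delta h F T"
    using y fin mono emp by (auto simp: mem_base_polytope_iff delta_top)
  have m: "F A \<le> F S" if "A \<subseteq> S" for A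
    using mono that S unfolding mono_on_def by (meson PowI order_trans)
  have finS: "finite S" using S fin by (rule finite_subset)
  have "(\<Sum>i\<in>S. \<bar>y i\<bar>) = (\<Sum>i\<in>?P. \<bar>y i\<bar>) + (\<Sum>i\<in>?M. \<bar>y i\<bar>)"
    using finS by (subst sum.union_disjoint[symmetric]) (auto intro: sum.cong)
  also have "\<dots> = sum y ?P - sum y ?M"
    by (simp add: sum_negf[symmetric])
  also have "\<dots> = sum y ?P + sum y (h - ?M)"
    using sum.subset_diff[of ?M h y] S fin y0 by (simp add: subset_iff)
  also have "\<dots> \<le> F ?P + F ?M"
  proof -
    have "h - (h - ?M) = ?M" using S by auto
    then have "sum y (h - ?M) \<le> F ?M"
      using le[of "h - ?M"] by (simp add: delta_def)
    moreover have "sum y ?P \<le> F ?P"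
      using le[of ?P] S by (auto simp: delta_def)
    ultimately show ?thesis by simp
  qed
  also have "\<dots> \<le> 2 * F S"
    using m[of ?P] m[of ?M] by auto
  finally show ?thesis .
qed

lemma base_polytope_subset_scaled_sym_polyhedron:
  assumes fin: "finite h" and mono: "mono_on (Pow h) F" and emp: "F {} = 0"
  shows "base_polytope h (delta h F) \<subseteq> scale_vec h 2 ` (sym_polyhedron h F \<inter> one_perp h)"
proof
  fix y assume y: "y \<in> base_polytope h (delta h F)"
  let ?z = "\<lambda>i\<in>h. y i / 2"
  have "y \<in> vecs h" "sum y h = 0"
    using y fin mono emp by (auto simp: mem_base_polytope_iff delta_top)
  then have "y = scale_vec h 2 ?z" "?z \<in> one_perp h"
    using fin by (auto simp: scale_vec_def vecs_def mem_one_perp_iff sum_divide_distrib[symmetric]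
        fun_eq_iff PiE_def extensional_def)
  moreover have "(\<Sum>i\<in>S. \<bar>?z i\<bar>) \<le> F S" if S: "S \<subseteq> h" for S
  proof -
    have "(\<Sum>i\<in>S. \<bar>?z i\<bar>) = (\<Sum>i\<in>S. \<bar>y i\<bar>) / 2"
      unfolding sum_divide_distrib by (intro sum.cong) (use S in auto)
    then show ?thesis
      using base_polytope_delta_sum_abs_le[OF fin mono emp y S] by simp
  qed
  then have "?z \<in> sym_polyhedron h F"
    by (simp add: sym_polyhedron_def vecs_def)
  ultimately show "y \<in> scale_vec h 2 ` (sym_polyhedron h F \<inter> one_perp h)" by blast
qed

section \<open>The greedy vertex and its optimality\<close>

lemma decreasing_enumeration:
  fixes x :: "'a \<Rightarrow> real"
  assumes "finite h"
  obtains e :: "nat \<Rightarrow> 'a" and n where "bij_betw e {..<n} h"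
    and "\<And>i j. i \<le> j \<Longrightarrow> j < n \<Longrightarrow> x (e j) \<le> x (e i)"
proof -
  obtain l where l: "set l = h" "distinct l" using finite_distinct_list[OF assms] by blast
  let ?s = "sort_key (\<lambda>i. - x i) l"
  have "bij_betw ((!) ?s) {..<length ?s} h"
    using l by (intro bij_betw_nth) auto
  moreover have "x (?s ! j) \<le> x (?s ! i)" if "i \<le> j" "j < length ?s" for i j
    using sorted_nth_mono[OF sorted_sort_key[of "\<lambda>i. - x i" l], of i j] that by simp
  ultimately show ?thesis using that by blast
qed

text \<open>Edmonds' vertex for the order \<open>e\<close>. Inverting \<open>e\<close> turns the
  marginal gains, naturally indexed by position, into a vector indexed by \<open>h\<close>.\<close>

definition greedy :: "'a set \<Rightarrow> ('a set \<Rightarrow> real) \<Rightarrow> nat \<Rightarrow> (nat \<Rightarrow> 'a) \<Rightarrow> 'a \<Rightarrow> real" where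
  "greedy h G n e =
     (\<lambda>i\<in>h. let k = the_inv_into {..<n} e i in G (e ` {..<Suc k}) - G (e ` {..<k}))"

lemma greedy_nth:
  assumes "bij_betw e {..<n} h" "k < n"
  shows "greedy h G n e (e k) = G (e ` {..<Suc k}) - G (e ` {..<k})"
proof -
  have "e k \<in> h" "the_inv_into {..<n} e (e k) = k"
    using assms by (auto simp: bij_betw_def the_inv_into_f_f)
  then show ?thesis by (simp add: greedy_def)
qed

lemma sum_enumeration:
  assumes "bij_betw e {..<n} h" "A \<subseteq> {..<n}"
  shows "sum f (e ` A) = (\<Sum>k\<in>A. f (e k))"
  using assms by (auto simp: bij_betw_def intro: sum.reindex_cong inj_on_subset)

text \<open>Telescoping: the greedy vector is tight on every prefix, which is what the Abel
  summations use of it.\<close>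

lemma sum_greedy_prefix:
  assumes e: "bij_betw e {..<n} h" and "k \<le> n" and "G {} = 0"
  shows "(\<Sum>j<k. greedy h G n e (e j)) = G (e ` {..<k})"
proof -
  have "(\<Sum>j<k. greedy h G n e (e j)) = (\<Sum>j<k. G (e ` {..<Suc j}) - G (e ` {..<j}))"
    using assms by (intro sum.cong) (auto simp: greedy_nth)
  also have "\<dots> = G (e ` {..<k})"
    using assms sum_lessThan_telescope[of "\<lambda>j. G (e ` {..<j})" k] by simp
  finally show ?thesis .
qed

lemma greedy_sum_le:
  assumes e: "bij_betw e {..<n} h" and sub: "submodular_on h G" and emp: "G {} = 0"
    and S: "S \<subseteq> h" and k: "k \<le> n"
  shows "sum (greedy h G n e) (S \<inter> e ` {..<k}) \<le> G (S \<inter> e ` {..<k})"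
  using k
proof (induction k)
  case 0
  then show ?case using emp by simp
next
  case (Suc k)
  have eh: "e ` {..<Suc k} \<subseteq> h" "e ` {..<k} \<subseteq> h"
    using e Suc.prems by (auto simp: bij_betw_def)
  have new: "e k \<notin> e ` {..<k}"
    using e Suc.prems by (auto simp: bij_betw_def dest!: inj_onD)
  have suc: "e ` {..<Suc k} = insert (e k) (e ` {..<k})" by (simp add: lessThan_Suc)
  show ?case
  proof (cases "e k \<in> S")
    case True
    let ?A = "S \<inter> e ` {..<Suc k}" and ?B = "e ` {..<k}"
    have "?A \<union> ?B = e ` {..<Suc k}" "?A \<inter> ?B = S \<inter> ?B"
      using True suc by auto
    \<comment> \<open>Diminishing returns: the gain of \<open>e k\<close> over the whole prefix
      \<open>?B\<close>, which is its greedy coordinate, is at most its gain over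
      \<open>S \<inter> ?B\<close>.\<close>
    then have "G (e ` {..<Suc k}) + G (S \<inter> ?B) \<le> G ?A + G ?B"
      using sub eh S unfolding submodular_on_def by (metis le_infI1)
    moreover have "?A = insert (e k) (S \<inter> ?B)" using True suc by auto
    then have "sum (greedy h G n e) ?A = greedy h G n e (e k) + sum (greedy h G n e) (S \<inter> ?B)"
      using new by simp
    ultimately show ?thesis
      using Suc greedy_nth[OF e, of k G] by simp
  next
    case False
    then have "S \<inter> e ` {..<Suc k} = S \<inter> e ` {..<k}" using suc by auto
    then show ?thesis using Suc by simp
  qed
qed

lemma greedy_in_base_polytope:
  assumes e: "bij_betw e {..<n} h" and sub: "submodular_on h G" and emp: "G {} = 0"
  shows "greedy h G n e \<in> base_polytope h G"
proof -
  have h: "e ` {..<n} = h" using e by (simp add: bij_betw_def)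
  then have "finite h" by auto
  moreover have "sum (greedy h G n e) h = G h"
    using sum_enumeration[OF e order_refl, of "greedy h G n e"] sum_greedy_prefix[OF e order_refl, of G]
      emp h by simp
  moreover have "sum (greedy h G n e) S \<le> G S" if "S \<subseteq> h" for S
    using greedy_sum_le[OF e sub emp that order_refl] h that by (simp add: Int_absorb2)
  moreover have "greedy h G n e \<in> vecs h" by (simp add: greedy_def vecs_def)
  ultimately show ?thesis by (simp add: mem_base_polytope_iff)
qed

text \<open>The prefix sums of \<open>?d\<close> are the slacks of \<open>y\<close> on prefixes,
  hence nonnegative, and Abel summation applies. The alternatives in \<open>or\<close> are the two
  ways to make the boundary term vanish; the second admits a \<open>y\<close> whose total falls
  below \<open>G h\<close>.\<close>

lemma greedy_optimal:
  assumes e: "bij_betw e {..<n} h" and dec: "\<And>i j. i \<le> j \<Longrightarrow> j < n \<Longrightarrow> x (e j) \<le> x (e i)"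
    and emp: "G {} = 0" and le: "\<And>S. S \<subseteq> h \<Longrightarrow> sum y S \<le> G S"
    and or: "sum y h = G h \<or> (\<forall>i\<in>h. 0 \<le> x i)"
  shows "inner_on h x y \<le> inner_on h x (greedy h G n e)"
proof -
  let ?z = "greedy h G n e"
  let ?d = "\<lambda>k. ?z (e k) - y (e k)"
  have h: "e ` {..<n} = h" using e by (simp add: bij_betw_def)
  have ys: "(\<Sum>j<k. y (e j)) = sum y (e ` {..<k})" if "k \<le> n" for k
    using sum_enumeration[OF e, of "{..<k}" y] that by simp
  have sub: "e ` {..<k} \<subseteq> h" if "k \<le> n" for k
    using h that by auto
  have D: "(\<Sum>j<k. ?d j) = G (e ` {..<k}) - sum y (e ` {..<k})" if "k \<le> n" for k
    using that ys[OF that] by (simp add: sum_subtractf sum_greedy_prefix[OF e] emp)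
  \<comment> \<open>A lower bound for \<open>x\<close> on \<open>h\<close>: 0 if \<open>x\<close> is
    nonnegative, otherwise its least value, in which case the total of \<open>?d\<close> vanishes.
    An empty \<open>h\<close> falls under the first branch, so \<open>n - 1\<close> is never
    truncated.\<close>
  define c where "c = (if \<forall>i\<in>h. 0 \<le> x i then 0 else x (e (n - 1)))"
  have "c * (\<Sum>k<n. ?d k) \<le> (\<Sum>k<n. x (e k) * ?d k)"
  proof (rule Abel_le_head)
    show "c \<le> x (e k)" if "k < n" for k
      using dec[of k "n - 1"] that h by (auto simp: c_def)
    show "0 \<le> (\<Sum>j<k. ?d j)" if "k \<le> n" for k
      using D[OF that] le[OF sub[OF that]] by simp
  qed (rule dec)
  moreover have "c * (\<Sum>k<n. ?d k) = 0"
    using or D[OF order_refl] h by (auto simp: c_def)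
  moreover have "(\<Sum>k<n. x (e k) * ?d k) = inner_on h x ?z - inner_on h x y"
    unfolding inner_on_def
    using sum_enumeration[OF e order_refl, of "\<lambda>i. x i * ?z i"]
      sum_enumeration[OF e order_refl, of "\<lambda>i. x i * y i"] h
    by (simp add: right_diff_distrib sum_subtractf)
  ultimately show ?thesis by simp
qed

text \<open>Resolves \<open>GREATEST\<close>: the greedy vector is both feasible and
  optimal.\<close>

lemma lovasz_ext_eq_greedy:
  assumes e: "bij_betw e {..<n} h" and dec: "\<And>i j. i \<le> j \<Longrightarrow> j < n \<Longrightarrow> x (e j) \<le> x (e i)"
    and sub: "submodular_on h G" and emp: "G {} = 0"
  shows "lovasz_ext h G x = inner_on h x (greedy h G n e)"
  unfolding lovasz_ext_def
proof (rule Greatest_equality)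
  have "finite h" using bij_betw_finite[OF e] by simp
  then show "r \<le> inner_on h x (greedy h G n e)" if "\<exists>y\<in>base_polytope h G. r = inner_on h x y" for r
    using that by (auto simp: mem_base_polytope_iff intro!: greedy_optimal[where e = e and x = x and G = G, OF e dec emp])
qed (use greedy_in_base_polytope[OF e sub emp] in blast)

lemma lovasz_ext_attained:
  assumes "finite h" "submodular_on h G" "G {} = 0"
  obtains y where "y \<in> base_polytope h G" "lovasz_ext h G x = inner_on h x y"
  using decreasing_enumeration[OF assms(1), of x] lovasz_ext_eq_greedy greedy_in_base_polytope assms
  by metis

lemma inner_le_lovasz_ext:
  assumes fin: "finite h" and sub: "submodular_on h G" and emp: "G {} = 0"
    and le: "\<And>S. S \<subseteq> h \<Longrightarrow> sum y S \<le> G S"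
    and or: "sum y h = G h \<or> (\<forall>i\<in>h. 0 \<le> x i)"
  shows "inner_on h x y \<le> lovasz_ext h G x"
proof -
  obtain e and n :: nat where e: "bij_betw e {..<n} h"
    and dec: "\<And>i j. i \<le> j \<Longrightarrow> j < n \<Longrightarrow> x (e j) \<le> x (e i)"
    using decreasing_enumeration[OF fin, of x] by blast
  show ?thesis
    using greedy_optimal[where e = e and x = x and G = G, OF e dec emp le or] lovasz_ext_eq_greedy[where e = e and x = x, OF e dec sub emp] by simp
qed

section \<open>Attainment of the minimum over shifts\<close>

text \<open>The coordinate is the total \<open>F h\<close> minus a sum that is at most
  \<open>F (h - {i})\<close>, and \<open>F\<close> is monotone.\<close>

lemma base_polytope_nonneg:
  assumes fin: "finite h" and mono: "mono_on (Pow h) F" and y: "y \<in> base_polytope h F" and i: "i \<in> h"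
  shows "0 \<le> y i"
proof -
  have "sum y h = y i + sum y (h - {i})" using fin i by (rule sum.remove)
  moreover have "sum y h = F h" "sum y (h - {i}) \<le> F (h - {i})"
    using y fin by (auto simp: mem_base_polytope_iff)
  moreover have "F (h - {i}) \<le> F h" using mono by (auto intro: mono_onD)
  ultimately show ?thesis by linarith
qed

text \<open>An optimal \<open>y\<close> for \<open>x\<close> is nonnegative with total
  \<open>F h\<close>, so adding \<open>c\<close> to every entry costs \<open>c * F h\<close>. With
  \<open>c = 0\<close> this is monotonicity of the norm, with \<open>c = \<bar>v - u\<bar>\<close> a
  Lipschitz bound in the shift.\<close>

lemma submod_norm_diff_le:
  assumes fin: "finite h" and mono: "mono_on (Pow h) F" and sub: "submodular_on h F" and emp: "F {} = 0"
    and le: "\<And>i. i \<in> h \<Longrightarrow> \<bar>x i\<bar> \<le> \<bar>x' i\<bar> + c"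
  shows "submod_norm h F x \<le> submod_norm h F x' + c * F h"
proof -
  obtain y where y: "y \<in> base_polytope h F"
    and eq: "lovasz_ext h F (abs_vec h x) = inner_on h (abs_vec h x) y"
    using lovasz_ext_attained[OF fin sub emp] by blast
  have yh: "sum y h = F h" "\<And>S. S \<subseteq> h \<Longrightarrow> sum y S \<le> F S"
    using y fin by (auto simp: mem_base_polytope_iff)
  have "inner_on h (abs_vec h x) y \<le> (\<Sum>i\<in>h. (\<bar>x' i\<bar> + c) * y i)"
    unfolding inner_on_def
    by (intro sum_mono mult_right_mono)
      (auto simp: abs_vec_def le base_polytope_nonneg[OF fin mono y])
  also have "\<dots> = inner_on h (abs_vec h x') y + c * F h"
    by (simp add: inner_on_def abs_vec_def distrib_right sum.distrib sum_distrib_left[symmetric] yh(1))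
  also have "inner_on h (abs_vec h x') y \<le> lovasz_ext h F (abs_vec h x')"
    by (rule inner_le_lovasz_ext[OF fin sub emp]) (use yh in auto)
  finally show ?thesis by (simp add: submod_norm_def eq)
qed

lemma diff_scale_one_vec: "i \<in> h \<Longrightarrow> diff_vec h x (scale_vec h u (one_vec h)) i = x i - u"
  by (simp add: diff_vec_def scale_vec_def ind_vec_def)

text \<open>\<open>N\<close> is Lipschitz, so it attains a minimum on the compact interval from the
  least to the greatest entry of \<open>x\<close>. Moving an outside shift to the nearer endpoint
  decreases every \<open>\<bar>x i - v\<bar>\<close>, so that minimum is global.\<close>

lemma submod_norm_shift_attains_min:
  fixes x :: "'a \<Rightarrow> real"
  assumes fin: "finite h" and mono: "mono_on (Pow h) F" and sub: "submodular_on h F" and emp: "F {} = 0"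
  defines "N \<equiv> \<lambda>u. submod_norm h F (diff_vec h x (scale_vec h u (one_vec h)))"
  shows "\<exists>u. \<forall>v. N u \<le> N v"
proof (cases "h = {}")
  case True
  then have "N u = N v" for u v by (simp add: N_def diff_vec_def restrict_def)
  then show ?thesis by (metis order_refl)
next
  case False
  define a b where "a = Min (x ` h)" and "b = Max (x ` h)"
  have ab: "a \<le> x i" "x i \<le> b" if "i \<in> h" for i
    using that fin by (auto simp: a_def b_def)
  have N_le: "N u \<le> N v + c * F h" if "\<And>i. i \<in> h \<Longrightarrow> \<bar>x i - u\<bar> \<le> \<bar>x i - v\<bar> + c" for u v c
    unfolding N_def
    by (rule submod_norm_diff_le[OF fin mono sub emp]) (simp add: diff_scale_one_vec that)
  have lip: "\<bar>N v - N u\<bar> \<le> \<bar>v - u\<bar> * F h" for u v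
    using N_le[of u v "\<bar>v - u\<bar>"] N_le[of v u "\<bar>v - u\<bar>"] by force
  have "isCont N u" for u
    unfolding isCont_def
  proof (rule LIM_zero_cancel, rule tendsto_rabs_zero_cancel, rule tendsto_sandwich)
    show "((\<lambda>v. 0) \<longlongrightarrow> 0) (at u)" by simp
    have "((\<lambda>v. \<bar>v - u\<bar> * F h) \<longlongrightarrow> \<bar>u - u\<bar> * F h) (at u)" by (intro tendsto_intros)
    then show "((\<lambda>v. \<bar>v - u\<bar> * F h) \<longlongrightarrow> 0) (at u)" by simp
  qed (use lip in auto)
  then have "continuous_on {a..b} N" by (simp add: continuous_at_imp_continuous_on)
  moreover have "{a..b} \<noteq> {}" using ab False by force
  ultimately obtain u where u: "u \<in> {a..b}" and min: "\<And>v. v \<in> {a..b} \<Longrightarrow> N u \<le> N v"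
    using continuous_attains_inf[of "{a..b}" N] by auto
  have "N u \<le> N v" for v
  proof -
    consider "v \<in> {a..b}" | "v < a" | "v > b" by fastforce
    then show ?thesis
    proof cases
      case 1
      then show ?thesis by (rule min)
    next
      case 2
      have "N a \<le> N v + 0 * F h" by (rule N_le) (use ab 2 in force)
      then show ?thesis using min[of a] u by simp
    next
      case 3
      have "N b \<le> N v + 0 * F h" by (rule N_le) (use ab 3 in force)
      then show ?thesis using min[of b] u by simp
    qed
  qed
  then show ?thesis by blast
qed

section \<open>The two bounds on the Lovasz extension\<close>

text \<open>An optimal \<open>y\<close> is \<open>2 z\<close> with \<open>z\<close> orthogonal to
  the ones vector, so shifting \<open>x\<close> leaves the pairing unchanged. The absolute values of
  \<open>z\<close> are dominated by \<open>F\<close>, so they pair with those of the shifted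
  \<open>x\<close> to at most the norm.\<close>

lemma lovasz_ext_delta_le:
  assumes fin: "finite h" and mono: "mono_on (Pow h) F" and sub: "submodular_on h F" and emp: "F {} = 0"
  shows "lovasz_ext h (delta h F) x \<le> 2 * submod_norm h F (diff_vec h x (scale_vec h u (one_vec h)))"
proof -
  let ?w = "diff_vec h x (scale_vec h u (one_vec h))"
  obtain y where y: "y \<in> base_polytope h (delta h F)"
    and eq: "lovasz_ext h (delta h F) x = inner_on h x y"
    using lovasz_ext_attained[OF fin submodular_on_delta[OF sub mono] delta_empty[OF mono emp]] by blast
  obtain z where z: "z \<in> sym_polyhedron h F" "z \<in> one_perp h" and yz: "y = scale_vec h 2 z"
    using base_polytope_subset_scaled_sym_polyhedron[OF fin mono emp] y by blast
  have "inner_on h x y = 2 * (\<Sum>i\<in>h. x i * z i)"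
    by (simp add: inner_on_def yz scale_vec_def sum_distrib_left mult_ac)
  also have "(\<Sum>i\<in>h. x i * z i) = (\<Sum>i\<in>h. (x i - u) * z i)"
    using z fin by (simp add: mem_one_perp_iff left_diff_distrib sum_subtractf sum_distrib_left[symmetric])
  also have "\<dots> \<le> inner_on h (abs_vec h ?w) (\<lambda>i. \<bar>z i\<bar>)"
    unfolding inner_on_def
    by (intro sum_mono) (auto simp: abs_vec_def diff_scale_one_vec abs_mult[symmetric])
  also have "\<dots> \<le> submod_norm h F ?w"
    unfolding submod_norm_def
    by (rule inner_le_lovasz_ext[OF fin sub emp]) (use z in \<open>auto simp: sym_polyhedron_def abs_vec_def\<close>)
  finally show ?thesis using eq by simp
qed

lemma exists_shift_submod_norm_le:
  assumes fin: "finite h" and mono: "mono_on (Pow h) F" and sub: "submodular_on h F" and emp: "F {} = 0"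
    and pos: "\<forall>i\<in>h. F {i} > 0"
  shows "\<exists>u. submod_norm h F (diff_vec h x (scale_vec h u (one_vec h))) \<le> lovasz_ext h (delta h F) x"
proof (cases "h = {}")
  case True
  then show ?thesis
    using lovasz_ext_attained[OF fin sub emp] lovasz_ext_attained[OF fin submodular_on_delta[OF sub mono] delta_empty[OF mono emp]]
    by (metis inner_on_def order_refl submod_norm_def sum.empty)
next
  case False
  obtain e and n :: nat where e: "bij_betw e {..<n} h"
    and dec: "\<And>i j. i \<le> j \<Longrightarrow> j < n \<Longrightarrow> x (e j) \<le> x (e i)"
    using decreasing_enumeration[OF fin, of x] by blast
  have h: "e ` {..<n} = h" and inj: "inj_on e {..<n}" using e by (auto simp: bij_betw_def)
  have sub_h: "e ` {..<k} \<subseteq> h" if "k \<le> n" for k using h that by auto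
  have m: "F A \<le> F B" if "A \<subseteq> B" "B \<subseteq> h" for A B
    using mono that unfolding mono_on_def by (meson PowI order_trans)
  \<comment> \<open>\<open>T\<close> holds the prefix lengths at which the minimum in
    \<open>delta h F\<close> is the value on the prefix itself; \<open>p\<close> is the last such
    length.\<close>
  define T where "T = {k. k \<le> n \<and> F (e ` {..<k}) \<le> F (h - e ` {..<k})}"
  define p where "p = Max T"
  have finT: "finite T" by (simp add: T_def)
  have "0 \<in> T" using m[of "{}" h] by (simp add: T_def)
  then have pT: "p \<in> T" using finT by (metis Max_in emptyE p_def)
  \<comment> \<open>Positivity on singletons makes \<open>F h\<close> exceed \<open>F {}\<close>;
    hence \<open>p < n\<close>, and \<open>e p\<close> is an element of \<open>h\<close>.\<close>
  have "n \<notin> T"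
  proof -
    obtain i where "i \<in> h" using False by blast
    then have "0 < F h" using pos m[of "{i}" h] by force
    then show ?thesis using h emp by (simp add: T_def)
  qed
  with pT have pn: "p < n" using T_def by (auto simp: order_less_le)
  \<comment> \<open>With growing \<open>k\<close> the prefix value increases and the complement
    value decreases, so \<open>T\<close> contains everything below \<open>p\<close>.\<close>
  have lowF: "delta h F (e ` {..<k}) = F (e ` {..<k})" if "k \<le> p" for k
  proof -
    have "F (e ` {..<k}) \<le> F (e ` {..<p})" using that pn sub_h by (intro m) auto
    also have "\<dots> \<le> F (h - e ` {..<p})" using pT by (simp add: T_def)
    also have "\<dots> \<le> F (h - e ` {..<k})" using that by (intro m) auto
    finally show ?thesis by (simp add: delta_def)
  qed
  have highF: "delta h F (e ` {..<k}) = F (h - e ` {..<k})" if "p < k" "k \<le> n" for k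
  proof -
    have "k \<notin> T" using Max_ge[OF finT, of k] that p_def by auto
    then show ?thesis using that by (simp add: T_def delta_def)
  qed
  \<comment> \<open>The greedy coordinate at \<open>e p\<close> mixes the two regimes: prefix length
    \<open>p\<close> uses \<open>F\<close> of the prefix, length \<open>p + 1\<close> uses
    \<open>F\<close> of the complement. With this \<open>u\<close> its coefficient
    \<open>x (e p) - u\<close> is zero.\<close>
  define u where "u = x (e p)"
  let ?w = "diff_vec h x (scale_vec h u (one_vec h))"
  let ?z = "greedy h (delta h F) n e"
  note d_emp = delta_empty[OF mono emp]
  note z_prefix = sum_greedy_prefix[where G = "delta h F", OF e _ d_emp]
  have z0: "(\<Sum>k<n. ?z (e k)) = 0"
    using z_prefix[OF order_refl] h delta_top[OF mono emp] by simp
  obtain y where y: "y \<in> base_polytope h F"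
    and eq: "lovasz_ext h F (abs_vec h ?w) = inner_on h (abs_vec h ?w) y"
    using lovasz_ext_attained[OF fin sub emp] by blast
  have y_le: "sum y S \<le> F S" if "S \<subseteq> h" for S
    using y fin that by (auto simp: mem_base_polytope_iff)
  \<comment> \<open>Before \<open>p\<close> the coefficients are nonnegative and decreasing, and
    prefix sums of \<open>?z\<close> equal \<open>F\<close> of the prefix, which dominates
    \<open>y\<close>.\<close>
  have head: "0 \<le> (\<Sum>k<p. (x (e k) - u) * (?z (e k) - y (e k)))"
  proof -
    have "0 * (\<Sum>k<p. ?z (e k) - y (e k)) \<le> (\<Sum>k<p. (x (e k) - u) * (?z (e k) - y (e k)))"
    proof (rule Abel_le_head)
      show "0 \<le> (\<Sum>j<k. ?z (e j) - y (e j))" if "k \<le> p" for k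
        using that pn z_prefix[of k] sum_enumeration[OF e, of "{..<k}" y] lowF[OF that]
          y_le[OF sub_h, of k] by (simp add: sum_subtractf)
    qed (use dec pn in \<open>auto simp: u_def\<close>)
    then show ?thesis by simp
  qed
  \<comment> \<open>After \<open>p\<close> all signs flip: since \<open>?z\<close> sums to zero,
    suffix sums of \<open>- ?z\<close> equal \<open>F\<close> of the suffix, which dominates
    \<open>y\<close>.\<close>
  have tail: "0 \<le> (\<Sum>k=Suc p..<n. (u - x (e k)) * (- ?z (e k) - y (e k)))"
  proof -
    have "0 * (\<Sum>k=Suc p..<n. - ?z (e k) - y (e k))
        \<le> (\<Sum>k=Suc p..<n. (u - x (e k)) * (- ?z (e k) - y (e k)))"
    proof (rule Abel_le_tail)
      show "0 \<le> (\<Sum>j=k..<n. - ?z (e j) - y (e j))" if k: "Suc p \<le> k" "k \<le> n" for k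
      proof -
        have split: "{..<n} = {..<k} \<union> {k..<n}" using k by auto
        then have "(\<Sum>j<n. ?z (e j)) = (\<Sum>j<k. ?z (e j)) + (\<Sum>j=k..<n. ?z (e j))"
          by (simp add: sum.union_disjoint ivl_disj_int)
        then have "- (\<Sum>j=k..<n. ?z (e j)) = F (h - e ` {..<k})"
          using z0 z_prefix[of k] highF[of k] k by simp
        moreover have "{k..<n} = {..<n} - {..<k}" by auto
        then have "e ` {k..<n} = h - e ` {..<k}"
          using h k inj_on_image_set_diff[OF inj, of "{..<n}" "{..<k}"] by (simp add: subset_iff)
        then have "(\<Sum>j=k..<n. y (e j)) \<le> F (h - e ` {..<k})"
          using sum_enumeration[OF e, of "{k..<n}" y] y_le[of "h - e ` {..<k}"] by force
        ultimately show ?thesis by (simp add: sum_subtractf sum_negf)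
      qed
    qed (use dec pn in \<open>auto simp: u_def\<close>)
    then show ?thesis by simp
  qed
  have split: "{..<n} = {..<p} \<union> insert p {Suc p..<n}" using pn by auto
  have "0 \<le> (\<Sum>k<n. (x (e k) - u) * ?z (e k) - \<bar>x (e k) - u\<bar> * y (e k))"
  proof -
    have "(\<Sum>k<p. (x (e k) - u) * ?z (e k) - \<bar>x (e k) - u\<bar> * y (e k))
        = (\<Sum>k<p. (x (e k) - u) * (?z (e k) - y (e k)))"
      using dec pn by (intro sum.cong) (auto simp: u_def right_diff_distrib)
    moreover have "(\<Sum>k=Suc p..<n. (x (e k) - u) * ?z (e k) - \<bar>x (e k) - u\<bar> * y (e k))
        = (\<Sum>k=Suc p..<n. (u - x (e k)) * (- ?z (e k) - y (e k)))"
    proof (intro sum.cong refl)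
      fix k assume "k \<in> {Suc p..<n}"
      then have "\<bar>x (e k) - u\<bar> = u - x (e k)" using dec[of p k] by (simp add: u_def)
      then show "(x (e k) - u) * ?z (e k) - \<bar>x (e k) - u\<bar> * y (e k)
          = (u - x (e k)) * (- ?z (e k) - y (e k))"
        by (simp add: algebra_simps)
    qed
    ultimately show ?thesis
      unfolding split using head tail by (subst sum.union_disjoint) (auto simp: u_def)
  qed
  \<comment> \<open>The shift drops out of the first sum because \<open>?z\<close> sums to
    zero.\<close>
  also have "\<dots> = (\<Sum>k<n. x (e k) * ?z (e k)) - (\<Sum>k<n. \<bar>x (e k) - u\<bar> * y (e k))"
    using z0 by (simp add: sum_subtractf left_diff_distrib sum_distrib_left[symmetric])
  also have "(\<Sum>k<n. x (e k) * ?z (e k)) = inner_on h x ?z"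
    using sum_enumeration[OF e order_refl, of "\<lambda>i. x i * ?z i"] h by (simp add: inner_on_def)
  also have "(\<Sum>k<n. \<bar>x (e k) - u\<bar> * y (e k)) = inner_on h (abs_vec h ?w) y"
    using sum_enumeration[OF e order_refl, of "\<lambda>i. \<bar>x i - u\<bar> * y i"] h
    by (simp add: inner_on_def abs_vec_def diff_scale_one_vec)
  finally have "submod_norm h F ?w \<le> lovasz_ext h (delta h F) x"
    using eq lovasz_ext_eq_greedy[where e = e and x = x, OF e dec submodular_on_delta[OF sub mono] d_emp]
    by (simp add: submod_norm_def)
  then show ?thesis by blast
qed

theorem mainTheorem5:
  fixes h :: "'a set" and F :: "'a set \<Rightarrow> real"
  assumes "finite h"
    and "mono_on (Pow h) F"
    and "submodular_on h F"
    and "F {} = 0"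
    and "\<forall>i\<in>h. F {i} > 0"
  shows "sym_polyhedron h F \<inter> one_perp h \<subseteq> base_polytope h (delta h F)
    \<and> base_polytope h (delta h F) \<subseteq> scale_vec h 2 ` (sym_polyhedron h F \<inter> one_perp h)
    \<and> (\<forall>x \<in> vecs h.
         let N = (\<lambda>u. submod_norm h F (diff_vec h x (scale_vec h u (one_vec h)))) in
           (\<exists>u. \<forall>v. N u \<le> N v)
         \<and> (LEAST r. \<exists>u. r = N u) \<le> lovasz_ext h (delta h F) x
         \<and> lovasz_ext h (delta h F) x \<le> 2 * (LEAST r. \<exists>u. r = N u))"
proof (intro conjI ballI)
  show "sym_polyhedron h F \<inter> one_perp h \<subseteq> base_polytope h (delta h F)"
    using assms by (intro sym_polyhedron_subset_base_polytope)
  show "base_polytope h (delta h F) \<subseteq> scale_vec h 2 ` (sym_polyhedron h F \<inter> one_perp h)"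
    using assms by (intro base_polytope_subset_scaled_sym_polyhedron)
next
  fix x :: "'a \<Rightarrow> real"
  let ?N = "\<lambda>u. submod_norm h F (diff_vec h x (scale_vec h u (one_vec h)))"
  obtain u where u: "\<And>v. ?N u \<le> ?N v"
    using submod_norm_shift_attains_min[OF assms(1-4)] by blast
  have least: "(LEAST r. \<exists>u. r = ?N u) = ?N u"
    by (rule Least_equality) (use u in auto)
  \<comment> \<open>The lower bound is known for some shift and passes to the minimizer
    \<open>u\<close>; the upper bound holds for every shift.\<close>
  have "?N u \<le> lovasz_ext h (delta h F) x"
    using exists_shift_submod_norm_le[OF assms, of x] u order_trans by blast
  moreover have "lovasz_ext h (delta h F) x \<le> 2 * ?N u"
    by (rule lovasz_ext_delta_le[OF assms(1-4)])
  ultimately show "let N = ?N in (\<exists>u. \<forall>v. N u \<le> N v)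
      \<and> (LEAST r. \<exists>u. r = N u) \<le> lovasz_ext h (delta h F) x
      \<and> lovasz_ext h (delta h F) x \<le> 2 * (LEAST r. \<exists>u. r = N u)"
    unfolding Let_def least using u by blast
qed

end
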